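(* If $C=\sum_{j=1}^kT_j$ is a simple and minimal $\Sigma\Pi\Sigma(k,d)$ identity, then every maximal chain of form-ideals $\mathcal{T}$ for $C$ has length $\#\mathcal{T}\le\binom{k}{2}(\log_2d+3)+(k-1)$.
   Context: Notation: $R=\mathbb{F}[x_1,\dots,x_n]$; linear forms $\sum_ia_ix_i$; $sp(X)$ is the span of a set $X$ of forms; $T_j=\alpha_jM(L(T_j))$ with $\alpha_j\in\mathbb{F}^*$, $L(T_j)$ the list of $d$ linear forms of $T_j$, $M(W)=\prod_{\ell\in W}\ell$; $L(C)$ is the union of the lists $L(T_j)$. $C$ simple: no nonzero linear form divides all $T_j$; minimal: $\sum_{j\in S}T_j\ne0$ for every proper subset $S\subsetneq[k]$; identity: $\sum_jT_j=0$. An ordered form-ideal is an ordered set $I=\{v_1,\dots,v_i\}$ of linearly independent linear forms; with $v_0=0$, $sp_j=sp(v_0,\dots,v_j)$, an ordered $I$-matching between lists $U,V$ is a bijection $\pi$ with $\pi(\ell)=c\ell+w$, $c\in\mathbb{F}^*$, $w\in sp_j$ for some $j$ with $\ell\notin sp_j$; the (unique) such $c=d_\ell$ gives scaling factor $sc(\pi)=\prod_{\ell\in U}d_\ell$. For a set $S$ of linear forms, $I$ is orthogonal to $S$ if $sp(S)\cap sp(I)=\{0\}$, and such $I$ is useful in $C$ w.r.t. $S$ if there is $Q\subset[k]$, $1<\#Q<k$ (a blocking subset of $C,S,I$) such that, with $V_q$ the sublist of $L(T_q)$ of forms not in $sp(S\cup I)\setminus sp(I)$, there is a list $V$ and ordered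 $I$-matchings $\tau_q:V\to V_q$ ($q\in Q$) with $\sum_{q\in Q}sc(\tau_q)\alpha_qM(L(T_q)\setminus V_q)\equiv0$ modulo the ideal generated by $I$ and each summand nonzero modulo that ideal. A chain of form-ideals for $C$ is an ordered set $\mathcal{T}=\{(C,S_1,I_1,Q_1),\dots,(C,S_m,I_m,Q_m)\}$ with $S_1=\emptyset$, $S_i=S_{i-1}\cup I_{i-1}$ for $2\le i\le m$, each $I_i$ an ordered form-ideal orthogonal to $S_i$ and useful in $C$ w.r.t. $S_i$, and $Q_i$ a blocking subset of $C,S_i,I_i$; $\#\mathcal{T}=m$. It is maximal if $L(C)\subseteq sp(S_m\cup I_m)$. *)

theory Defs
  imports "HOL-Analysis.Cartesian_Space" "HOL-Library.Poly_Mapping"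
begin

text \<open>
  The polynomial ring in the variables \<open>x\<^sub>i\<close>, \<open>i :: 'n\<close>, is the type
  \<open>('n \<Rightarrow>\<^sub>0 nat) \<Rightarrow>\<^sub>0 'a\<close> (monomials to coefficients); the linear order on the
  index type is what makes it an instance of \<open>idom\<close>.  The linear form
  \<open>\<Sum>i. a\<^sub>i x\<^sub>i\<close> is represented by its coefficient vector in \<open>'a ^ 'n\<close>, so that spans
  and independence of forms are \<open>vec.span\<close> and \<open>vec.independent\<close>.
\<close>

type_synonym ('a, 'n) mpoly = "('n \<Rightarrow>\<^sub>0 nat) \<Rightarrow>\<^sub>0 'a"

definition const_poly :: "'a::comm_ring_1 \<Rightarrow> ('a, 'n) mpoly" where
  "const_poly a = Poly_Mapping.single 0 a"

definition var_poly :: "'n \<Rightarrow> ('a::comm_ring_1, 'n) mpoly" where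
  "var_poly i = Poly_Mapping.single (Poly_Mapping.single i 1) 1"

definition form_poly :: "'a::comm_ring_1 ^ 'n::finite \<Rightarrow> ('a, 'n) mpoly" where
  "form_poly v = (\<Sum>i\<in>UNIV. const_poly (v $ i) * var_poly i)"

definition forms_prod :: "('a::comm_ring_1 ^ 'n::finite) list \<Rightarrow> ('a, 'n) mpoly" where
  "forms_prod W = prod_list (map form_poly W)"

text \<open>The ideal generated by \<open>B\<close>: the span of \<open>B\<close> in the ring as a module over itself.\<close>

definition ideal_gen :: "('r::comm_ring_1) set \<Rightarrow> 'r set" where
  "ideal_gen B = module.span (*) B"

text \<open>
  A term \<open>(\<alpha>, W)\<close> stands for \<open>\<alpha> \<cdot> M(W)\<close>; a circuit is the list of its terms, and \<open>[k]\<close>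
  becomes the index set \<open>{..<k}\<close>.
\<close>

type_synonym ('a, 'n) mult_term = "'a \<times> ('a ^ 'n) list"
type_synonym ('a, 'n) circuit = "('a, 'n) mult_term list"

definition term_poly :: "('a::comm_ring_1, 'n::finite) mult_term \<Rightarrow> ('a, 'n) mpoly" where
  "term_poly t = const_poly (fst t) * forms_prod (snd t)"

definition depth3_circuit :: "nat \<Rightarrow> nat \<Rightarrow> ('a::field, 'n::finite) circuit \<Rightarrow> bool" where
  "depth3_circuit k d C \<longleftrightarrow> length C = k \<and> (\<forall>t\<in>set C. fst t \<noteq> 0 \<and> length (snd t) = d)"

definition circuit_forms :: "('a, 'n::finite) circuit \<Rightarrow> ('a ^ 'n) set" where
  "circuit_forms C = (\<Union>t\<in>set C. set (snd t))"

definition is_identity :: "('a::field, 'n::finite) circuit \<Rightarrow> bool" where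
  "is_identity C \<longleftrightarrow> (\<Sum>j<length C. term_poly (C ! j)) = 0"

definition simple_circuit :: "('a::field, 'n::finite) circuit \<Rightarrow> bool" where
  "simple_circuit C \<longleftrightarrow>
     \<not> (\<exists>l :: 'a ^ 'n. l \<noteq> 0 \<and> (\<forall>j<length C. form_poly l dvd term_poly (C ! j)))"

text \<open>The empty subset has to be excluded, its sum being \<open>0\<close>.\<close>

definition minimal_circuit :: "('a::field, 'n::finite) circuit \<Rightarrow> bool" where
  "minimal_circuit C \<longleftrightarrow>
     (\<forall>S. S \<noteq> {} \<and> S \<subset> {..<length C} \<longrightarrow> (\<Sum>j\<in>S. term_poly (C ! j)) \<noteq> 0)"

definition form_ideal :: "('a::field ^ 'n::finite) list \<Rightarrow> bool" where
  "form_ideal I \<longleftrightarrow> distinct I \<and> vec.independent (set I)"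

text \<open>\<open>prefix_span I j\<close> is \<open>sp(0, v\<^sub>1, \<dots>, v\<^sub>j)\<close> for \<open>I = [v\<^sub>1, \<dots>, v\<^sub>i]\<close> and \<open>j \<le> i\<close>.\<close>

definition prefix_span :: "('a::field ^ 'n::finite) list \<Rightarrow> nat \<Rightarrow> ('a ^ 'n) set" where
  "prefix_span I j = vec.span (set (take j I))"

definition matches ::
  "('a::field ^ 'n::finite) list \<Rightarrow> 'a ^ 'n \<Rightarrow> 'a ^ 'n \<Rightarrow> 'a \<Rightarrow> bool" where
  "matches I l m c \<longleftrightarrow>
     c \<noteq> 0 \<and> (\<exists>j\<le>length I. l \<notin> prefix_span I j \<and> (\<exists>w\<in>prefix_span I j. m = c *s l + w))"

text \<open>Lists may have repeated entries, so a bijection of lists is one of their index sets.\<close>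

definition ordered_matching ::
  "('a::field ^ 'n::finite) list \<Rightarrow> ('a ^ 'n) list \<Rightarrow> ('a ^ 'n) list \<Rightarrow> (nat \<Rightarrow> nat) \<Rightarrow> bool" where
  "ordered_matching I U V \<pi> \<longleftrightarrow>
     bij_betw \<pi> {..<length U} {..<length V} \<and>
     (\<forall>i<length U. \<exists>c. matches I (U ! i) (V ! \<pi> i) c)"

definition scaling ::
  "('a::field ^ 'n::finite) list \<Rightarrow> ('a ^ 'n) list \<Rightarrow> ('a ^ 'n) list \<Rightarrow> (nat \<Rightarrow> nat) \<Rightarrow> 'a" where
  "scaling I U V \<pi> = (\<Prod>i<length U. THE c. matches I (U ! i) (V ! \<pi> i) c)"

definition orthogonal_forms ::
  "('a::field ^ 'n::finite) list \<Rightarrow> ('a ^ 'n) set \<Rightarrow> bool" where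
  "orthogonal_forms I S \<longleftrightarrow> vec.span S \<inter> vec.span (set I) = {0}"

text \<open>With \<open>W = L(T\<^sub>q)\<close>, the first sublist below is \<open>V\<^sub>q\<close> and the second \<open>L(T\<^sub>q) \<setminus> V\<^sub>q\<close>.\<close>

definition outer_forms ::
  "('a::field ^ 'n::finite) set \<Rightarrow> ('a ^ 'n) list \<Rightarrow> ('a ^ 'n) list \<Rightarrow> ('a ^ 'n) list" where
  "outer_forms S I W = filter (\<lambda>l. l \<notin> vec.span (S \<union> set I) - vec.span (set I)) W"

definition inner_forms ::
  "('a::field ^ 'n::finite) set \<Rightarrow> ('a ^ 'n) list \<Rightarrow> ('a ^ 'n) list \<Rightarrow> ('a ^ 'n) list" where
  "inner_forms S I W = filter (\<lambda>l. l \<in> vec.span (S \<union> set I) - vec.span (set I)) W"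

definition blocking_subset ::
  "('a::field, 'n::finite) circuit \<Rightarrow> ('a ^ 'n) set \<Rightarrow> ('a ^ 'n) list \<Rightarrow> nat set \<Rightarrow> bool" where
  "blocking_subset C S I Q \<longleftrightarrow>
     Q \<subseteq> {..<length C} \<and> 1 < card Q \<and> card Q < length C \<and>
     (\<exists>V \<tau>.
        (\<forall>q\<in>Q. ordered_matching I V (outer_forms S I (snd (C ! q))) (\<tau> q)) \<and>
        (let summand = (\<lambda>q. const_poly (scaling I V (outer_forms S I (snd (C ! q))) (\<tau> q) * fst (C ! q))
                              * forms_prod (inner_forms S I (snd (C ! q))));
             J = ideal_gen (form_poly ` set I)
         in (\<Sum>q\<in>Q. summand q) \<in> J \<and> (\<forall>q\<in>Q. summand q \<notin> J)))"

definition useful ::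
  "('a::field, 'n::finite) circuit \<Rightarrow> ('a ^ 'n) set \<Rightarrow> ('a ^ 'n) list \<Rightarrow> bool" where
  "useful C S I \<longleftrightarrow> orthogonal_forms I S \<and> (\<exists>Q. blocking_subset C S I Q)"

text \<open>A chain is the list of its triples \<open>(S\<^sub>i, I\<^sub>i, Q\<^sub>i)\<close>, the common circuit being a parameter.\<close>

type_synonym ('a, 'n) chain = "(('a ^ 'n) set \<times> ('a ^ 'n) list \<times> nat set) list"

abbreviation "chain_S T i \<equiv> fst (T ! i)"
abbreviation "chain_I T i \<equiv> fst (snd (T ! i))"
abbreviation "chain_Q T i \<equiv> snd (snd (T ! i))"

definition form_ideal_chain ::
  "('a::field, 'n::finite) circuit \<Rightarrow> ('a, 'n) chain \<Rightarrow> bool" where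
  "form_ideal_chain C T \<longleftrightarrow>
     T \<noteq> [] \<and> chain_S T 0 = {} \<and>
     (\<forall>i. 0 < i \<and> i < length T \<longrightarrow>
        chain_S T i = chain_S T (i - 1) \<union> set (chain_I T (i - 1))) \<and>
     (\<forall>i<length T.
        form_ideal (chain_I T i) \<and> orthogonal_forms (chain_I T i) (chain_S T i) \<and>
        useful C (chain_S T i) (chain_I T i) \<and>
        blocking_subset C (chain_S T i) (chain_I T i) (chain_Q T i))"

definition maximal_chain ::
  "('a::field, 'n::finite) circuit \<Rightarrow> ('a, 'n) chain \<Rightarrow> bool" where
  "maximal_chain C T \<longleftrightarrow>
     form_ideal_chain C T \<and>
     circuit_forms C \<subseteq> vec.span (chain_S T (length T - 1) \<union> set (chain_I T (length T - 1)))"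

lemma module_mult: "module ((*) :: 'r::comm_ring_1 \<Rightarrow> 'r \<Rightarrow> 'r)"
  by unfold_locales (simp_all add: algebra_simps)

lemma prefix_span_mono: "i \<le> j \<Longrightarrow> prefix_span I i \<subseteq> prefix_span I j"
  unfolding prefix_span_def by (intro vec.span_mono set_take_subset_set_take)

text \<open>The definite description in \<open>scaling\<close> is well defined.\<close>

lemma matches_unique:
  assumes "matches I l m c" "matches I l m c'"
  shows "c = c'"
proof -
  obtain i w where i: "l \<notin> prefix_span I i" "w \<in> prefix_span I i" "m = c *s l + w"
    using assms(1) unfolding matches_def by blast
  obtain j w' where j: "l \<notin> prefix_span I j" "w' \<in> prefix_span I j" "m = c' *s l + w'"
    using assms(2) unfolding matches_def by blast
  define h where "h = max i j"
  have l: "l \<notin> prefix_span I h" using i(1) j(1) by (auto simp: h_def max_def)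
  have "w \<in> prefix_span I h" "w' \<in> prefix_span I h"
    using i(2) j(2) prefix_span_mono[of i h I] prefix_span_mono[of j h I] by (auto simp: h_def)
  then have "w' - w \<in> prefix_span I h"
    unfolding prefix_span_def by (intro vec.span_diff)
  moreover have "w' - w = (c - c') *s l"
    using i(3) j(3) by (simp add: vec.scale_left_diff_distrib algebra_simps)
  ultimately have "(c - c') *s l \<in> vec.span (set (take h I))"
    by (simp add: prefix_span_def)
  then show "c = c'"
    using l vec.span_scale[of "(c - c') *s l" "set (take h I)" "inverse (c - c')"]
    by (cases "c = c'") (auto simp: prefix_span_def)
qed

end

theory Submission
  imports Defs "HOL-Library.Multiset"
begin

text \<open>
  For a form \<open>x\<close> and a term \<open>T\<^sub>a\<close>, count the factors of \<open>T\<^sub>a\<close> that are proportional to \<open>x\<close>.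
  Call step \<open>n\<close> of the chain separating for \<open>a, b \<in> Q\<^sub>n\<close> if these counts differ for some \<open>x\<close>
  outside \<open>sp(S\<^sub>n \<union> I\<^sub>n)\<close>.

  If \<open>x\<close> witnesses the last separating step for \<open>a, b\<close>, then for every separating step the
  matching forces a second differing form in each coset of \<open>sp(I\<^sub>n)\<close> that contains one.  As the
  \<open>I\<^sub>n\<close> are independent of each other, \<open>t\<close> separating steps yield \<open>2\<^sup>t\<close> pairwise
  non-proportional factors, whence \<open>2\<^sup>t \<le> 2d\<close>.

  A step separating for no pair merges classes of the equivalence relation on terms
  \<open>equal counts outside sp(S\<^sub>n)\<close>: otherwise the terms in \<open>Q\<^sub>n\<close> differ only by factors from
  \<open>sp(S\<^sub>n)\<close>, and a relation modulo \<open>I\<^sub>n\<close> between products of forms from \<open>sp(S\<^sub>n)\<close> is an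
  identity, so the terms in \<open>Q\<^sub>n\<close> sum to zero.  Hence there are at most \<open>k - 1\<close> such steps.
\<close>

section \<open>Substitution of forms into polynomials\<close>

lemma const_poly_0 [simp]: "const_poly 0 = 0"
  and const_poly_1 [simp]: "const_poly 1 = 1"
  and const_poly_add: "const_poly (a + b) = const_poly a + const_poly b"
  and const_poly_mult: "const_poly (a * b) = const_poly a * const_poly b"
  by (simp_all add: const_poly_def single_add mult_single)

definition monom_subst :: "('n::finite \<Rightarrow> ('a::comm_ring_1, 'n) mpoly) \<Rightarrow> ('n \<Rightarrow>\<^sub>0 nat) \<Rightarrow> ('a, 'n) mpoly"
  where "monom_subst \<sigma> m = (\<Prod>i\<in>UNIV. \<sigma> i ^ Poly_Mapping.lookup m i)"

text \<open>The algebra endomorphism sending the variable \<open>i\<close> to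
  \<open>\<sigma> i\<close>.\<close>

definition poly_subst :: "('n::finite \<Rightarrow> ('a::comm_ring_1, 'n) mpoly) \<Rightarrow> ('a, 'n) mpoly \<Rightarrow> ('a, 'n) mpoly"
  where "poly_subst \<sigma> p = (\<Sum>m\<in>Poly_Mapping.keys p. const_poly (Poly_Mapping.lookup p m) * monom_subst \<sigma> m)"

lemma monom_subst_0 [simp]: "monom_subst \<sigma> 0 = 1"
  by (simp add: monom_subst_def)

lemma monom_subst_add: "monom_subst \<sigma> (m + n) = monom_subst \<sigma> m * monom_subst \<sigma> n"
  by (simp add: monom_subst_def lookup_add power_add prod.distrib)

text \<open>Extra monomials have coefficient 0. Additivity needs one index set for three
  polynomials, since cancellation can make \<open>keys (p + q)\<close> smaller than the
  union.\<close>

lemma poly_subst_superset: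
  assumes "finite A" "Poly_Mapping.keys p \<subseteq> A"
  shows "poly_subst \<sigma> p = (\<Sum>m\<in>A. const_poly (Poly_Mapping.lookup p m) * monom_subst \<sigma> m)"
  unfolding poly_subst_def using assms
  by (intro sum.mono_neutral_left) (auto simp: in_keys_iff)

lemma poly_subst_0 [simp]: "poly_subst \<sigma> 0 = 0"
  by (simp add: poly_subst_def)

lemma poly_subst_add: "poly_subst \<sigma> (p + q) = poly_subst \<sigma> p + poly_subst \<sigma> q"
proof -
  let ?A = "Poly_Mapping.keys p \<union> Poly_Mapping.keys q"
  have "poly_subst \<sigma> (p + q) = (\<Sum>m\<in>?A. const_poly (Poly_Mapping.lookup (p + q) m) * monom_subst \<sigma> m)"
    using Poly_Mapping.keys_add[of p q] by (intro poly_subst_superset) auto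
  also have "\<dots> = (\<Sum>m\<in>?A. const_poly (Poly_Mapping.lookup p m) * monom_subst \<sigma> m)
      + (\<Sum>m\<in>?A. const_poly (Poly_Mapping.lookup q m) * monom_subst \<sigma> m)"
    by (simp add: lookup_add const_poly_add algebra_simps sum.distrib)
  also have "\<dots> = poly_subst \<sigma> p + poly_subst \<sigma> q"
    by (simp add: poly_subst_superset[of ?A])
  finally show ?thesis .
qed

lemma poly_subst_sum: "poly_subst \<sigma> (\<Sum>x\<in>A. f x) = (\<Sum>x\<in>A. poly_subst \<sigma> (f x))"
  by (induction A rule: infinite_finite_induct) (simp_all add: poly_subst_add)

lemma poly_subst_single: "poly_subst \<sigma> (Poly_Mapping.single m a) = const_poly a * monom_subst \<sigma> m"
  by (cases "a = 0") (simp_all add: poly_subst_def)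

lemma poly_mapping_eq_sum_single:
  "(\<Sum>m\<in>Poly_Mapping.keys p. Poly_Mapping.single m (Poly_Mapping.lookup p m)) = p"
  by (rule poly_mapping_eqI) (simp add: lookup_sum lookup_single when_def in_keys_iff)

text \<open>Expanding both factors into monomials reduces the claim to
  \<open>monom_subst_add\<close>.\<close>

lemma poly_subst_mult: "poly_subst \<sigma> (p * q) = poly_subst \<sigma> p * poly_subst \<sigma> q"
proof -
  let ?s = "\<lambda>p m. Poly_Mapping.single m (Poly_Mapping.lookup p m)"
  have "p * q = (\<Sum>m\<in>Poly_Mapping.keys p. ?s p m) * (\<Sum>n\<in>Poly_Mapping.keys q. ?s q n)"
    by (simp add: poly_mapping_eq_sum_single)
  also have "\<dots> = (\<Sum>m\<in>Poly_Mapping.keys p. \<Sum>n\<in>Poly_Mapping.keys q. Poly_Mapping.single (m + n) (Poly_Mapping.lookup p m * Poly_Mapping.lookup q n))"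
    by (simp add: sum_product mult_single)
  finally have "poly_subst \<sigma> (p * q) = (\<Sum>m\<in>Poly_Mapping.keys p. \<Sum>n\<in>Poly_Mapping.keys q.
      poly_subst \<sigma> (Poly_Mapping.single (m + n) (Poly_Mapping.lookup p m * Poly_Mapping.lookup q n)))"
    by (simp only: poly_subst_sum)
  then show ?thesis
    by (simp add: poly_subst_single monom_subst_add const_poly_mult poly_subst_def[of _ p]
        poly_subst_def[of _ q] sum_product mult_ac)
qed

lemma poly_subst_const [simp]: "poly_subst \<sigma> (const_poly a) = const_poly a"
  using poly_subst_single[of \<sigma> 0 a] by (simp add: const_poly_def)

lemma poly_subst_var [simp]: "poly_subst \<sigma> (var_poly i) = \<sigma> i"
proof -
  have "(\<Prod>j\<in>UNIV. \<sigma> j ^ Poly_Mapping.lookup (Poly_Mapping.single i 1) j) = (\<Prod>j\<in>UNIV. if j = i then \<sigma> i else 1)"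
    by (intro prod.cong) (auto simp: lookup_single when_def)
  then show ?thesis
    by (simp add: var_poly_def poly_subst_single monom_subst_def)
qed

section \<open>Linear forms as polynomials and linear substitutions\<close>

lemma form_poly_add: "form_poly (v + w) = form_poly v + form_poly w"
  by (simp add: form_poly_def const_poly_add algebra_simps sum.distrib)

lemma form_poly_scale: "form_poly (c *s v) = const_poly c * form_poly v"
  by (simp add: form_poly_def const_poly_mult sum_distrib_left mult_ac)

lemma form_poly_0 [simp]: "form_poly 0 = 0"
  by (simp add: form_poly_def)

lemma form_poly_sum: "form_poly (\<Sum>x\<in>A. f x) = (\<Sum>x\<in>A. form_poly (f x))"
  by (induction A rule: infinite_finite_induct) (simp_all add: form_poly_add)

lemma lookup_form_poly: "Poly_Mapping.lookup (form_poly v) (Poly_Mapping.single i 1) = v $ i"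
proof -
  have "Poly_Mapping.lookup (form_poly v) (Poly_Mapping.single i 1)
      = (\<Sum>j\<in>UNIV. Poly_Mapping.lookup (const_poly (v $ j) * var_poly j) (Poly_Mapping.single i 1))"
    by (simp add: form_poly_def lookup_sum)
  also have "\<dots> = (\<Sum>j\<in>UNIV. if j = i then v $ i else 0)"
    by (intro sum.cong)
      (auto simp: const_poly_def var_poly_def mult_single lookup_single when_def
        dest: arg_cong[of _ _ "\<lambda>m. Poly_Mapping.lookup m i"])
  finally show ?thesis by simp
qed

lemma form_poly_eq_0_iff [simp]: "form_poly v = 0 \<longleftrightarrow> v = 0"
proof
  assume "form_poly v = 0"
  then have "v $ i = 0" for i using lookup_form_poly[of v i] by simp
  then show "v = 0" by (simp add: vec_eq_iff)
qed simp

definition form_subst :: "('a::field ^ 'n::finite \<Rightarrow> 'a ^ 'n) \<Rightarrow> ('a, 'n) mpoly \<Rightarrow> ('a, 'n) mpoly"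
  where "form_subst \<phi> = poly_subst (\<lambda>i. form_poly (\<phi> (axis i 1)))"

lemma form_subst_form_poly:
  assumes "Vector_Spaces.linear (*s) (*s) \<phi>"
  shows "form_subst \<phi> (form_poly v) = form_poly (\<phi> v)"
proof -
  interpret \<phi>: Vector_Spaces.linear "(*s)" "(*s)" \<phi> by fact
  have "\<phi> v = \<phi> (\<Sum>i\<in>UNIV. v $ i *s axis i 1)" by (simp add: basis_expansion)
  also have "\<dots> = (\<Sum>i\<in>UNIV. v $ i *s \<phi> (axis i 1))" by (simp add: \<phi>.sum \<phi>.scale)
  finally show ?thesis
    unfolding form_subst_def form_poly_def[of v]
    by (simp add: poly_subst_sum poly_subst_mult form_poly_sum form_poly_scale)
qed

lemma form_subst_forms_prod:
  assumes "Vector_Spaces.linear (*s) (*s) \<phi>"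
  shows "form_subst \<phi> (forms_prod W) = forms_prod (map \<phi> W)"
proof (induction W)
  case Nil
  then show ?case
    using poly_subst_const[of "\<lambda>i. form_poly (\<phi> (axis i 1))" 1]
    by (simp add: forms_prod_def form_subst_def)
next
  case (Cons v W)
  then show ?case
    using form_subst_form_poly[OF assms, of v]
    by (simp add: forms_prod_def form_subst_def poly_subst_mult)
qed

text \<open>The kernel of a ring homomorphism is an ideal, so killing the generators is
  enough.\<close>

lemma form_subst_ideal_gen:
  assumes "Vector_Spaces.linear (*s) (*s) \<phi>"
    and "\<And>v. v \<in> A \<Longrightarrow> \<phi> v = 0" and "p \<in> ideal_gen (form_poly ` A)"
  shows "form_subst \<phi> p = 0"
proof -
  interpret ring: module "(*) :: ('a, 'b) mpoly \<Rightarrow> _" by (rule module_mult)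
  have "p \<in> ring.span (form_poly ` A)" using assms(3) by (simp add: ideal_gen_def)
  then show ?thesis
  proof (induction rule: ring.span_induct_alt)
    case base
    show ?case by (simp add: form_subst_def)
  next
    case (step c x y)
    then have "form_subst \<phi> x = 0" using assms by (auto simp: form_subst_form_poly)
    with step show ?case by (simp add: form_subst_def poly_subst_add poly_subst_mult)
  qed
qed

text \<open>The polynomial ring is an integral domain; this is where the order on \<open>'n\<close>
  enters.\<close>

lemma forms_prod_nonzero:
  fixes W :: "('a::field ^ 'n::{finite,linorder}) list"
  assumes "0 \<notin> set W"
  shows "forms_prod W \<noteq> 0"
  using assms by (induction W) (auto simp: forms_prod_def)

lemma prod_list_filter_partition:
  fixes f :: "'b \<Rightarrow> 'c::comm_monoid_mult"
  shows "prod_list (map f W) = prod_list (map f (filter P W)) * prod_list (map f (filter (\<lambda>x. \<not> P x) W))"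
  by (induction W) (simp_all add: mult_ac)

text \<open>Because the spans meet trivially, bases of the two are jointly independent, so a linear
  map may be prescribed on their union.\<close>

lemma projection_exists:
  assumes "vec.span A \<inter> vec.span B = {0}"
  obtains \<phi> :: "'a::field ^ 'n::finite \<Rightarrow> 'a ^ 'n" where "Vector_Spaces.linear (*s) (*s) \<phi>"
    "\<And>v. v \<in> vec.span A \<Longrightarrow> \<phi> v = v" "\<And>v. v \<in> vec.span B \<Longrightarrow> \<phi> v = 0"
proof -
  obtain A' where A': "A' \<subseteq> vec.span A" "vec.independent A'" "vec.span A \<subseteq> vec.span A'"
    using vec.maximal_independent_subset[of "vec.span A"] by metis
  obtain B' where B': "B' \<subseteq> vec.span B" "vec.independent B'" "vec.span B \<subseteq> vec.span B'"
    using vec.maximal_independent_subset[of "vec.span B"] by metis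
  have zero: "x = 0" if "x \<in> vec.span A'" "x \<in> vec.span B'" for x
    using that assms vec.span_minimal[OF A'(1) vec.subspace_span]
      vec.span_minimal[OF B'(1) vec.subspace_span] by blast
  have "finite A'" using A'(2) by (rule vec.finiteI_independent)
  \<comment> \<open>The vectors of \<open>A'\<close> are added to \<open>B'\<close> one at a time; a
    dependence \<open>a = s + t\<close> puts \<open>t\<close> into both spans, so
    \<open>t = 0\<close> and \<open>a\<close> would depend on the rest of \<open>A'\<close>.\<close>
  then have indep: "vec.independent (A' \<union> B')"
  proof (rule finite_subset_induct'[of A' A' "\<lambda>X. vec.independent (X \<union> B')", OF _ subset_refl])
    show "vec.independent ({} \<union> B')" using B'(2) by simp
  next
    fix a X assume a: "a \<in> A'" "X \<subseteq> A'" "a \<notin> X" "vec.independent (X \<union> B')"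
    have "a \<notin> vec.span (X \<union> B')"
    proof
      assume "a \<in> vec.span (X \<union> B')"
      then obtain s t where st: "s \<in> vec.span X" "t \<in> vec.span B'" "a = s + t"
        by (auto simp: vec.span_Un)
      have "t = a - s" using st(3) by simp
      moreover have "s \<in> vec.span A'" using st(1) a(2) vec.span_mono by blast
      ultimately have "t = 0"
        using zero st(2) a(1) vec.span_diff[OF vec.span_base[OF a(1)]] by blast
      then have "a \<in> vec.span X" using st by simp
      then have "a \<in> vec.span (A' - {a})" using a vec.span_mono[of X "A' - {a}"] by blast
      then show False using A'(2) a(1) by (auto simp: vec.dependent_def)
    qed
    then show "vec.independent (insert a X \<union> B')"
      using a(4) by (simp add: vec.independent_insert)
  qed
  obtain \<phi> where \<phi>: "Vector_Spaces.linear (*s) (*s) \<phi>"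
    "\<And>v. v \<in> A' \<union> B' \<Longrightarrow> \<phi> v = (if v \<in> A' then v else 0)"
    using vec.linear_independent_extend[OF indep, of "\<lambda>v. if v \<in> A' then v else 0"] by blast
  have A1: "\<phi> v = v" if "v \<in> A'" for v
    using that \<phi>(2)[of v] by simp
  have B0: "\<phi> v = 0" if "v \<in> B'" for v
    using that \<phi>(2)[of v] zero[OF vec.span_base vec.span_base, of v] by (cases "v \<in> A'") simp_all
  show ?thesis
  proof
    show "\<phi> v = v" if "v \<in> vec.span A" for v
      using \<phi>(1) vec.linear_ident by (rule vec.linear_eq_on[where B = A']) (use that A'(3) A1 in blast)+
    show "\<phi> v = 0" if "v \<in> vec.span B" for v
      using \<phi>(1) vec.linear_zero by (rule vec.linear_eq_on[where B = B']) (use that B'(3) B0 in blast)+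
  qed (rule \<phi>(1))
qed

section \<open>Scaling factors of ordered matchings\<close>

lemma scale_mem_span_iff:
  fixes v :: "'a::field ^ 'n::finite"
  assumes "c \<noteq> 0"
  shows "c *s v \<in> vec.span A \<longleftrightarrow> v \<in> vec.span A"
proof
  assume "c *s v \<in> vec.span A"
  then have "inverse c *s (c *s v) \<in> vec.span A" by (rule vec.span_scale)
  then show "v \<in> vec.span A" using assms by simp
qed (rule vec.span_scale)

text \<open>Take \<open>j = 0\<close> and \<open>w = 0\<close>. Consequently any functional
  compatible with \<open>matches\<close> is homogeneous on nonzero forms.\<close>

lemma matches_scale:
  assumes "l \<noteq> 0" "c \<noteq> 0"
  shows "matches I l (c *s l) c"
proof -
  have "prefix_span I 0 = {0}" by (simp add: prefix_span_def)
  then have "l \<notin> prefix_span I 0 \<and> (\<exists>w\<in>prefix_span I 0. c *s l = c *s l + w)"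
    using assms by simp
  then show ?thesis using assms(2) unfolding matches_def by blast
qed

lemma matches_nonzero:
  assumes "matches I l m c"
  shows "l \<noteq> 0" "m \<noteq> 0"
proof -
  obtain j w where j: "c \<noteq> 0" "l \<notin> prefix_span I j" "w \<in> prefix_span I j" "m = c *s l + w"
    using assms unfolding matches_def by blast
  show "l \<noteq> 0" using j(2) vec.span_zero by (auto simp: prefix_span_def)
  show "m \<noteq> 0"
  proof
    assume "m = 0"
    then have "c *s l = - w" using j(4) by (simp add: eq_neg_iff_add_eq_0)
    then have "c *s l \<in> prefix_span I j" using j(3) by (simp add: prefix_span_def vec.span_neg)
    then show False using j(1,2) by (simp add: prefix_span_def scale_mem_span_iff)
  qed
qed

text \<open>
  The functional is the leading coefficient along a complete flag that refines the flag of
  prefix spans of \<open>I\<close>.  It makes the scaling factor of a matching depend only on the two lists.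
\<close>

lemma leading_coefficient_exists:
  fixes I :: "('a::field ^ 'n::finite) list"
  obtains lc where "\<And>l. l \<noteq> 0 \<Longrightarrow> lc l \<noteq> 0"
    and "\<And>l m c. matches I l m c \<Longrightarrow> lc m = c * lc l"
proof -
  obtain B :: "('a ^ 'n) list" where B: "set B = cart_basis"
    using finite_list[OF finite_cart_basis] by blast
  \<comment> \<open>Appending a basis makes the flag exhaust the space. \<open>F\<close> may be
    dependent; the flag then merely stands still at some indices, and these never lead.\<close>
  define F where "F = I @ B"
  define P where "P = prefix_span F"
  have P_I: "P j = prefix_span I j" if "j \<le> length I" for j
    using that by (simp add: P_def F_def prefix_span_def)
  have P_mono: "P i \<subseteq> P j" if "i \<le> j" for i j
    using that unfolding P_def by (rule prefix_span_mono)
  have P_sub: "vec.subspace (P j)" for j by (simp add: P_def prefix_span_def)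
  have P_Suc: "x \<in> P (Suc j) \<longleftrightarrow> (\<exists>a. x - a *s F ! j \<in> P j)" if "j < length F" for x j
    using that by (simp add: P_def prefix_span_def take_Suc_conv_app_nth vec.span_breakdown_eq)
  have P_top: "P (length F) = UNIV"
  proof -
    have "vec.span (set B) \<subseteq> P (length F)"
      by (auto simp: P_def F_def prefix_span_def intro!: vec.span_mono)
    then show ?thesis using B by auto
  qed
  \<comment> \<open>\<open>j\<close> is the index at which \<open>l\<close> enters the flag, and
    \<open>a\<close> is its coordinate along \<open>F ! j\<close> modulo \<open>P j\<close>.\<close>
  define lead where "lead l j a \<longleftrightarrow> j < length F \<and> l \<notin> P j \<and> l - a *s F ! j \<in> P j" for l j a
  have lead_ex: "\<exists>j a. lead l j a" if "l \<noteq> 0" for l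
  proof -
    have "l \<in> P (length F)" "l \<notin> P 0" using P_top that by (auto simp: P_def prefix_span_def)
    then have "\<exists>j<length F. l \<notin> P j \<and> l \<in> P (Suc j)"
      using ex_least_nat_less[of "\<lambda>j. l \<in> P j" "length F"] by auto
    then show ?thesis unfolding lead_def using P_Suc by blast
  qed
  have lead_le: "j \<le> j'" if "lead l j a" "lead l j' a'" for l j a j' a'
  proof (rule ccontr)
    assume "\<not> j \<le> j'"
    moreover have "l \<in> P (Suc j')" using that P_Suc by (auto simp: lead_def)
    ultimately show False using that P_mono[of "Suc j'" j] by (auto simp: lead_def)
  qed
  have lead_nz: "a \<noteq> 0" if "lead l j a" for l j a
    using that by (auto simp: lead_def)
  have lead_unique: "a = a'" if l: "lead l j a" "lead l j' a'" for l j a j' a'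
  proof (rule ccontr)
    assume neq: "a \<noteq> a'"
    have [simp]: "j' = j" using lead_le[OF l] lead_le[OF l(2) l(1)] by simp
    let ?v = "F ! j"
    have la: "l - a *s ?v \<in> P j" and la': "l - a' *s ?v \<in> P j" using l by (simp_all add: lead_def)
    have "(l - a *s ?v) - (l - a' *s ?v) \<in> P j" using la la' by (rule vec.subspace_diff[OF P_sub])
    moreover have "(l - a *s ?v) - (l - a' *s ?v) = (a' - a) *s ?v"
      by (simp add: vec.scale_left_diff_distrib)
    ultimately have "inverse (a' - a) *s ((a' - a) *s ?v) \<in> P j"
      using vec.subspace_scale[OF P_sub] by metis
    then have "?v \<in> P j" using neq by simp
    then have "(l - a *s ?v) + a *s ?v \<in> P j"
      using la vec.subspace_add[OF P_sub] vec.subspace_scale[OF P_sub] by blast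
    then show False using l by (simp add: lead_def)
  qed
  define lc where "lc l = (THE a. \<exists>j. lead l j a)" for l
  have lc: "lc l = a" if "lead l j a" for l j a
    unfolding lc_def using that lead_unique by (intro the_equality) blast+
  show ?thesis
  proof
    show "lc l \<noteq> 0" if "l \<noteq> 0" for l
      using lead_ex[OF that] lc lead_nz by blast
    show "lc m = c * lc l" if m: "matches I l m c" for l m c
    proof -
      obtain i w where i: "c \<noteq> 0" "i \<le> length I" "l \<notin> P i" "w \<in> P i" "m = c *s l + w"
        using m P_I unfolding matches_def by metis
      obtain j a where l: "lead l j a" using lead_ex matches_nonzero(1)[OF m] by blast
      \<comment> \<open>So \<open>w\<close> lies strictly below the leading index of
        \<open>l\<close>: adding it changes neither that index nor the leading coefficient of
        \<open>c *s l\<close>.\<close>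
      have "i \<le> j"
      proof (rule ccontr)
        assume "\<not> i \<le> j"
        moreover have "l \<in> P (Suc j)" using l P_Suc by (auto simp: lead_def)
        ultimately show False using i(3) P_mono[of "Suc j" i] by auto
      qed
      then have w: "w \<in> P j" using i(4) P_mono by blast
      have "m \<notin> P j"
      proof
        assume "m \<in> P j"
        then have "m - w \<in> P j" using w by (rule vec.subspace_diff[OF P_sub])
        then have "inverse c *s (m - w) \<in> P j" by (rule vec.subspace_scale[OF P_sub])
        then show False using i(1,5) l by (simp add: lead_def)
      qed
      moreover have "m - (c * a) *s F ! j = c *s (l - a *s F ! j) + w"
        using i(5) by (simp add: vec.scale_right_diff_distrib)
      moreover have "c *s (l - a *s F ! j) + w \<in> P j"
        using l w vec.subspace_scale[OF P_sub] vec.subspace_add[OF P_sub] by (simp add: lead_def)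
      ultimately have "lead m j (c * a)" using l by (simp add: lead_def)
      then show ?thesis using lc l by metis
    qed
  qed
qed

text \<open>Each factor of the scaling is a ratio of two leading coefficients; the bijection
  reindexes the product of the numerators.\<close>

lemma scaling_leading_coefficient:
  assumes "ordered_matching I U V \<pi>"
    and lc: "\<And>l m c. matches I l m c \<Longrightarrow> lc m = c * lc l"
  shows "scaling I U V \<pi> * prod_list (map lc U) = prod_list (map lc V)"
proof -
  have bij: "bij_betw \<pi> {..<length U} {..<length V}"
    and m: "\<And>i. i < length U \<Longrightarrow> \<exists>c. matches I (U ! i) (V ! \<pi> i) c"
    using assms(1) by (auto simp: ordered_matching_def)
  have pl: "prod_list (map lc W) = (\<Prod>i<length W. lc (W ! i))" for W
    by (simp add: prod.list_conv_set_nth atLeast0LessThan)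
  have "scaling I U V \<pi> * prod_list (map lc U)
      = (\<Prod>i<length U. (THE c. matches I (U ! i) (V ! \<pi> i) c) * lc (U ! i))"
    by (simp add: scaling_def pl prod.distrib)
  also have "\<dots> = (\<Prod>i<length U. lc (V ! \<pi> i))"
  proof (rule prod.cong)
    fix i assume "i \<in> {..<length U}"
    then obtain c where c: "matches I (U ! i) (V ! \<pi> i) c" using m by auto
    then have "(THE c. matches I (U ! i) (V ! \<pi> i) c) = c"
      using matches_unique by blast
    then show "(THE c. matches I (U ! i) (V ! \<pi> i) c) * lc (U ! i) = lc (V ! \<pi> i)"
      using lc[OF c] by simp
  qed simp
  also have "\<dots> = (\<Prod>i<length V. lc (V ! i))"
    using prod.reindex_bij_betw[OF bij] by simp
  finally show ?thesis by (simp add: pl)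
qed

lemma ordered_matching_nonzero:
  assumes "ordered_matching I U V \<pi>"
  shows "0 \<notin> set U" "0 \<notin> set V"
proof -
  have bij: "bij_betw \<pi> {..<length U} {..<length V}"
    and m: "\<And>i. i < length U \<Longrightarrow> \<exists>c. matches I (U ! i) (V ! \<pi> i) c"
    using assms by (auto simp: ordered_matching_def)
  show "0 \<notin> set U"
    using m matches_nonzero(1) by (metis in_set_conv_nth)
  show "0 \<notin> set V"
  proof
    assume "0 \<in> set V"
    then obtain i where "i < length V" "V ! i = 0" by (metis in_set_conv_nth)
    moreover have "\<pi> ` {..<length U} = {..<length V}" using bij by (rule bij_betw_imp_surj_on)
    ultimately have "i \<in> \<pi> ` {..<length U}" by simp
    then obtain j where "j < length U" "V ! \<pi> j = 0" using \<open>V ! i = 0\<close> by auto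
    then show False using m matches_nonzero(2) by blast
  qed
qed

section \<open>Counting proportional forms\<close>

text \<open>The nonzero scalar makes this an equivalence relation; the classes of nonzero forms are
  points of projective space.\<close>

definition proportional :: "'a::field ^ 'n::finite \<Rightarrow> 'a ^ 'n \<Rightarrow> bool" where
  "proportional x y \<longleftrightarrow> (\<exists>c. c \<noteq> 0 \<and> y = c *s x)"

definition prop_count :: "'a::field ^ 'n::finite \<Rightarrow> ('a ^ 'n) list \<Rightarrow> nat" where
  "prop_count x W = length (filter (proportional x) W)"

lemma proportional_mem_span_iff:
  "proportional x y \<Longrightarrow> y \<in> vec.span A \<longleftrightarrow> x \<in> vec.span A"
  by (auto simp: proportional_def scale_mem_span_iff)

text \<open>A scaling-invariant predicate keeps or drops a proportionality class as a whole.\<close>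

lemma prop_count_filter:
  assumes "\<And>y. proportional x y \<Longrightarrow> P y \<longleftrightarrow> P x"
  shows "prop_count x (filter P W) = (if P x then prop_count x W else 0)"
  using assms by (induction W) (auto simp: prop_count_def)

lemma forms_prod_normalize:
  fixes W :: "('a::field ^ 'n::finite) list"
  assumes "\<And>l. l \<in> set W \<Longrightarrow> lc l \<noteq> 0"
  shows "forms_prod W = const_poly (prod_list (map lc W)) * forms_prod (map (\<lambda>l. inverse (lc l) *s l) W)"
  using assms
proof (induction W)
  case (Cons l W)
  have "form_poly l = form_poly (lc l *s (inverse (lc l) *s l))"
    using Cons.prems[of l] by simp
  then have "form_poly l = const_poly (lc l) * form_poly (inverse (lc l) *s l)"
    by (simp only: form_poly_scale)
  with Cons show ?case by (simp add: forms_prod_def const_poly_mult mult_ac)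
qed (simp add: forms_prod_def)

text \<open>\<open>inverse (lc l) *s l\<close> is the one member of the class of \<open>l\<close>
  with leading coefficient 1, so the class counts determine the normalized multiset.\<close>

lemma mset_normalize_eq:
  assumes lc: "\<And>l. l \<noteq> 0 \<Longrightarrow> lc l \<noteq> 0" "\<And>l c. l \<noteq> 0 \<Longrightarrow> c \<noteq> 0 \<Longrightarrow> lc (c *s l) = c * lc l"
    and "0 \<notin> set U" "0 \<notin> set V"
    and eq: "\<And>x. x \<noteq> 0 \<Longrightarrow> prop_count x U = prop_count x V"
  shows "mset (map (\<lambda>l. inverse (lc l) *s l) U) = mset (map (\<lambda>l. inverse (lc l) *s l) V)"
proof (rule multiset_eqI)
  fix z
  let ?n = "\<lambda>l. inverse (lc l) *s l"
  have cnt: "count (mset (map ?n W)) z = (if z \<noteq> 0 \<and> lc z = 1 then prop_count z W else 0)"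
    if "0 \<notin> set W" for W
    using that
  proof (induction W)
    case (Cons l W)
    have l: "l \<noteq> 0" "lc l \<noteq> 0" using Cons.prems lc by auto
    have "?n l = z \<longleftrightarrow> z \<noteq> 0 \<and> lc z = 1 \<and> proportional z l"
    proof
      assume z: "?n l = z"
      then have "lc z = inverse (lc l) * lc l" using lc(2)[of l "inverse (lc l)"] l by simp
      moreover have "l = lc l *s z" using z l by auto
      ultimately show "z \<noteq> 0 \<and> lc z = 1 \<and> proportional z l"
        using z l unfolding proportional_def by (metis left_inverse vec.scale_zero_right)
    next
      assume z: "z \<noteq> 0 \<and> lc z = 1 \<and> proportional z l"
      then obtain c where c: "c \<noteq> 0" "l = c *s z" by (auto simp: proportional_def)
      then have "lc l = c" using lc(2) z by simp
      then show "?n l = z" using c by simp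
    qed
    then show ?case using Cons by (auto simp: prop_count_def)
  qed (simp add: prop_count_def)
  show "count (mset (map ?n U)) z = count (mset (map ?n V)) z"
    using cnt assms by simp
qed

section \<open>Separation of terms by a blocking subset\<close>

lemma outer_inner_forms_prod:
  "forms_prod W = forms_prod (inner_forms S I W) * forms_prod (outer_forms S I W)"
  unfolding forms_prod_def inner_forms_def outer_forms_def by (rule prod_list_filter_partition)

lemma forms_prod_mset_cong: "mset U = mset V \<Longrightarrow> forms_prod U = forms_prod V"
  unfolding forms_prod_def by (metis mset_map prod_mset_prod_list)

text \<open>
  If all terms indexed by \<open>Q\<close> agreed up to scaling outside the span of \<open>S\<close>, their sum would be
  a common factor times a polynomial in forms from the span of \<open>S\<close>, which vanishes modulo \<open>I\<close>
  only if it is zero: then the sum over \<open>Q\<close> contradicts minimality.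
\<close>

lemma blocking_subset_separates:
  fixes C :: "('a::field, 'n::{finite,linorder}) circuit"
  assumes min: "minimal_circuit C" and orth: "orthogonal_forms I S"
    and block: "blocking_subset C S I Q"
  obtains a b x where "a \<in> Q" "b \<in> Q" "x \<notin> vec.span S"
    "prop_count x (snd (C ! a)) \<noteq> prop_count x (snd (C ! b))"
proof (rule ccontr)
  assume "\<not> thesis"
  with that have eq: "prop_count x (snd (C ! a)) = prop_count x (snd (C ! b))"
    if "a \<in> Q" "b \<in> Q" "x \<notin> vec.span S" for a b x
    using that by blast
  define out where "out q = outer_forms S I (snd (C ! q))" for q
  define inn where "inn q = inner_forms S I (snd (C ! q))" for q
  \<comment> \<open>The inner forms are split so that a projection onto the span of \<open>S\<close>
    fixes \<open>inS q\<close>, while \<open>offS q\<close> is, up to scalars, the same for all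
    \<open>q\<close>.\<close>
  define inS where "inS q = filter (\<lambda>l. l \<in> vec.span S) (inn q)" for q
  define offS where "offS q = filter (\<lambda>l. l \<notin> vec.span S) (inn q)" for q
  obtain V \<tau> where Q: "Q \<subseteq> {..<length C}" "1 < card Q" "card Q < length C"
    and \<tau>: "\<And>q. q \<in> Q \<Longrightarrow> ordered_matching I V (out q) (\<tau> q)"
    and sum: "(\<Sum>q\<in>Q. const_poly (scaling I V (out q) (\<tau> q) * fst (C ! q)) * forms_prod (inn q))
      \<in> ideal_gen (form_poly ` set I)"
    using block unfolding blocking_subset_def Let_def out_def inn_def by blast
  obtain q0 where q0: "q0 \<in> Q" using Q(2) by fastforce
  obtain lc :: "('a, 'n) vec \<Rightarrow> 'a" where lc0: "\<And>l. l \<noteq> 0 \<Longrightarrow> lc l \<noteq> 0"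
    and lcm: "\<And>l m c. matches I l m c \<Longrightarrow> lc m = c * lc l"
    using leading_coefficient_exists[of I] by blast
  have lcs: "lc (c *s l) = c * lc l" if "l \<noteq> 0" "c \<noteq> 0" for l c
    using lcm[OF matches_scale[OF that]] .
  let ?N = "map (\<lambda>l. inverse (lc l) *s l)"
  let ?L = "\<lambda>W. prod_list (map lc W)"
  have zero: "x = 0" if "x \<in> vec.span S" "x \<in> vec.span (set I)" for x
    using orth that by (auto simp: orthogonal_forms_def)
  have sub: "vec.span S \<subseteq> vec.span (S \<union> set I)" by (intro vec.span_mono) auto
  have out0: "0 \<notin> set (out q)" if "q \<in> Q" for q
    using ordered_matching_nonzero(2)[OF \<tau>[OF that]] .
  have out_eq: "forms_prod (?N (out q)) = forms_prod (?N (out q0))" if q: "q \<in> Q" for q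
  proof (intro forms_prod_mset_cong mset_normalize_eq lc0 lcs out0 q q0)
    fix x :: "('a, 'n) vec" assume x: "x \<noteq> 0"
    have "prop_count x (out r) = (if x \<notin> vec.span (S \<union> set I) - vec.span (set I)
        then prop_count x (snd (C ! r)) else 0)" for r
      unfolding out_def outer_forms_def
      by (rule prop_count_filter) (simp add: proportional_mem_span_iff)
    \<comment> \<open>A form in the span of \<open>S\<close> lies in that of
      \<open>S \<union> set I\<close>; not being inner would put it in the span of \<open>I\<close>
      too, hence make it 0 by orthogonality.\<close>
    moreover have "x \<notin> vec.span S" if "x \<notin> vec.span (S \<union> set I) - vec.span (set I)"
      using that zero sub x by blast
    ultimately show "prop_count x (out q) = prop_count x (out q0)"
      using eq[OF q q0] by simp
  qed
  have offS0: "0 \<notin> set (offS q)" for q by (auto simp: offS_def vec.span_zero)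
  have offS_eq: "forms_prod (?N (offS q)) = forms_prod (?N (offS q0))" if q: "q \<in> Q" for q
  proof (intro forms_prod_mset_cong mset_normalize_eq lc0 lcs offS0)
    fix x :: "('a, 'n) vec" assume x: "x \<noteq> 0"
    have "prop_count x (offS r) = (if x \<notin> vec.span S \<and> x \<in> vec.span (S \<union> set I) - vec.span (set I)
        then prop_count x (snd (C ! r)) else 0)" for r
      unfolding offS_def inn_def inner_forms_def filter_filter
      by (subst prop_count_filter) (auto simp: proportional_mem_span_iff)
    then show "prop_count x (offS q) = prop_count x (offS q0)"
      using eq[OF q q0] by simp
  qed
  have norm: "forms_prod W = const_poly (?L W) * forms_prod (?N W)" if "0 \<notin> set W" for W
    using that lc0 by (intro forms_prod_normalize) metis
  define sc where "sc q = scaling I V (out q) (\<tau> q) * fst (C ! q)" for q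
  \<comment> \<open>\<open>G\<close> and \<open>H\<close> are the normalized products shared by all
    \<open>q\<close>; \<open>Z\<close> collects what is left and involves only forms from the span
    of \<open>S\<close>.\<close>
  define G where "G = forms_prod (?N (out q0))"
  define H where "H = forms_prod (?N (offS q0))"
  define Z where "Z = (\<Sum>q\<in>Q. const_poly (sc q * ?L (offS q)) * forms_prod (inS q))"
  have inn: "forms_prod (inn q) = forms_prod (inS q) * (const_poly (?L (offS q)) * H)" if "q \<in> Q" for q
  proof -
    have "forms_prod (inn q) = forms_prod (inS q) * forms_prod (offS q)"
      unfolding forms_prod_def inS_def offS_def by (rule prod_list_filter_partition)
    then show ?thesis using norm[OF offS0] offS_eq[OF that] by (simp add: H_def)
  qed
  have sumH: "(\<Sum>q\<in>Q. const_poly (sc q) * forms_prod (inn q)) = H * Z"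
    unfolding Z_def sum_distrib_left
    by (intro sum.cong) (simp_all add: inn const_poly_mult mult_ac)
  \<comment> \<open>Substituting \<open>\<phi>\<close> kills the ideal of \<open>I\<close> but fixes
    \<open>Z\<close>, so the relation modulo \<open>I\<close> becomes an exact equation.\<close>
  obtain \<phi> :: "('a, 'n) vec \<Rightarrow> ('a, 'n) vec" where \<phi>: "Vector_Spaces.linear (*s) (*s) \<phi>"
    "\<And>v. v \<in> vec.span S \<Longrightarrow> \<phi> v = v" "\<And>v. v \<in> vec.span (set I) \<Longrightarrow> \<phi> v = 0"
    using projection_exists[of S "set I"] orth by (auto simp: orthogonal_forms_def)
  interpret \<phi>: Vector_Spaces.linear "(*s)" "(*s)" \<phi> by fact
  have "form_subst \<phi> (H * Z) = 0"
    using form_subst_ideal_gen[OF \<phi>(1) _ sum] \<phi>(3) sumH by (simp add: sc_def vec.span_base)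
  then have HZ: "form_subst \<phi> H * form_subst \<phi> Z = 0"
    by (simp add: form_subst_def poly_subst_mult)
  \<comment> \<open>Writing \<open>l = s + t\<close> gives \<open>\<phi> l = s\<close>; were this 0,
    \<open>l\<close> would lie in the span of \<open>I\<close>, which inner forms avoid.\<close>
  have "form_subst \<phi> H \<noteq> 0"
  proof -
    have "\<phi> (inverse (lc l) *s l) \<noteq> 0" if l: "l \<in> set (offS q0)" for l
    proof
      assume "\<phi> (inverse (lc l) *s l) = 0"
      moreover have "lc l \<noteq> 0" using l offS0 lc0 by metis
      ultimately have "\<phi> l = 0" by (simp add: \<phi>.scale)
      have "l \<in> vec.span (S \<union> set I)" "l \<notin> vec.span (set I)"
        using l by (auto simp: offS_def inn_def inner_forms_def)
      moreover then obtain s t where "s \<in> vec.span S" "t \<in> vec.span (set I)" "l = s + t"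
        by (auto simp: vec.span_Un)
      ultimately show False using \<open>\<phi> l = 0\<close> \<phi> by (simp add: \<phi>.add)
    qed
    then have "0 \<notin> set (map \<phi> (?N (offS q0)))" by auto
    then show ?thesis unfolding H_def form_subst_forms_prod[OF \<phi>(1)] by (rule forms_prod_nonzero)
  qed
  moreover have "form_subst \<phi> Z = Z"
  proof -
    have "form_subst \<phi> (forms_prod (inS q)) = forms_prod (inS q)" for q
    proof -
      have "map \<phi> (inS q) = inS q" by (rule map_idI) (simp add: inS_def \<phi>(2))
      then show ?thesis by (simp only: form_subst_forms_prod[OF \<phi>(1)])
    qed
    then show ?thesis
      unfolding Z_def form_subst_def by (simp add: poly_subst_sum poly_subst_mult)
  qed
  ultimately have Z: "Z = 0" using HZ by simp
  \<comment> \<open>Normalizing \<open>out q\<close> releases exactly its scaling factor times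
    \<open>?L V\<close>. The source \<open>V\<close> is common to all matchings, so each term is a
    common factor times its summand in the blocking relation.\<close>
  have "term_poly (C ! q) = const_poly (?L V) * G * (const_poly (sc q) * forms_prod (inn q))"
    if q: "q \<in> Q" for q
  proof -
    have "term_poly (C ! q) = const_poly (fst (C ! q)) * (forms_prod (inn q) * forms_prod (out q))"
      unfolding term_poly_def inn_def out_def by (metis outer_inner_forms_prod)
    also have "forms_prod (out q) = const_poly (scaling I V (out q) (\<tau> q) * ?L V) * G"
      using norm[OF out0[OF q]] out_eq[OF q] scaling_leading_coefficient[OF \<tau>[OF q] lcm]
      by (simp add: G_def)
    finally show ?thesis by (simp add: sc_def const_poly_mult mult_ac)
  qed
  then have "(\<Sum>q\<in>Q. term_poly (C ! q)) = const_poly (?L V) * G * (H * Z)"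
    unfolding sumH[symmetric] sum_distrib_left by (intro sum.cong) simp_all
  then have "(\<Sum>q\<in>Q. term_poly (C ! q)) = 0" using Z by simp
  moreover have "Q \<noteq> {}" "Q \<subset> {..<length C}" using Q by auto
  ultimately show False using min unfolding minimal_circuit_def by blast
qed

section \<open>Doubling along orthogonal form-ideals\<close>

text \<open>From \<open>c *s y = e *s z\<close> follows
  \<open>(c - e) *s x \<in> vec.span A\<close>, which forces \<open>c = e\<close>: a proportionality
  class meets a coset off the span at most once.\<close>

lemma proportional_coset_unique:
  fixes x y z u :: "'a::field ^ 'n::finite"
  assumes x: "x \<notin> vec.span A" and "y - x \<in> vec.span A" "z - x \<in> vec.span A"
    and "proportional y u" "proportional z u"
  shows "y = z"
proof -
  obtain c e where c: "c \<noteq> 0" "u = c *s y" and e: "e \<noteq> 0" "u = e *s z"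
    using assms(4,5) unfolding proportional_def by blast
  have "e *s (z - x) - c *s (y - x) \<in> vec.span A"
    using assms(2,3) vec.span_diff vec.span_scale by blast
  moreover have "e *s (z - x) - c *s (y - x) = (c - e) *s x"
    using c(2) e(2) by (simp add: algebra_simps)
  ultimately have "c = e"
    using x scale_mem_span_iff[of "c - e" x A] by auto
  then show ?thesis using c e by simp
qed

text \<open>The classes of the members of \<open>X\<close> are disjoint, so no entry is counted
  twice.\<close>

lemma sum_prop_count:
  assumes "finite X"
    and "\<And>y z u. y \<in> X \<Longrightarrow> z \<in> X \<Longrightarrow> proportional y u \<Longrightarrow> proportional z u \<Longrightarrow> y = z"
  shows "(\<Sum>y\<in>X. prop_count y W) = length (filter (\<lambda>u. \<exists>y\<in>X. proportional y u) W)"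
proof (induction W)
  case (Cons u W)
  have "(\<Sum>y\<in>X. prop_count y (u # W))
      = (\<Sum>y\<in>X. (if proportional y u then 1 else 0) + prop_count y W)"
    by (intro sum.cong) (auto simp: prop_count_def)
  also have "\<dots> = (\<Sum>y\<in>X. if proportional y u then 1 else 0) + (\<Sum>y\<in>X. prop_count y W)"
    by (rule sum.distrib)
  also have "(\<Sum>y\<in>X. if proportional y u then 1 else 0) = (if \<exists>y\<in>X. proportional y u then 1 else 0 :: nat)"
  proof (cases "\<exists>y\<in>X. proportional y u")
    case True
    then obtain y where "y \<in> X" "proportional y u" by blast
    then have "(\<Sum>z\<in>X. if proportional z u then 1 else 0) = (\<Sum>z\<in>X. if z = y then 1 else 0 :: nat)"
      using assms(2) by (intro sum.cong) auto
    then show ?thesis using True assms(1) \<open>y \<in> X\<close> by simp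
  qed simp
  finally show ?case using Cons by auto
qed (simp add: prop_count_def)

text \<open>The matching restricts to a bijection between the positions where \<open>P\<close>
  holds.\<close>

lemma ordered_matching_length_filter:
  assumes "ordered_matching I U V \<pi>"
    and "\<And>l m c. matches I l m c \<Longrightarrow> P m \<longleftrightarrow> P l"
  shows "length (filter P U) = length (filter P V)"
proof -
  have bij: "bij_betw \<pi> {..<length U} {..<length V}"
    and m: "\<And>i. i < length U \<Longrightarrow> P (V ! \<pi> i) \<longleftrightarrow> P (U ! i)"
    using assms by (auto simp: ordered_matching_def)
  have surj: "\<pi> ` {..<length U} = {..<length V}" using bij by (rule bij_betw_imp_surj_on)
  have "\<pi> ` {i. i < length U \<and> P (U ! i)} = {i. i < length V \<and> P (V ! i)}"
  proof (intro equalityI subsetI)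
    fix i assume i: "i \<in> {i. i < length V \<and> P (V ! i)}"
    then have "i \<in> \<pi> ` {..<length U}" using surj by simp
    then obtain j where "j < length U" "i = \<pi> j" by auto
    then show "i \<in> \<pi> ` {i. i < length U \<and> P (U ! i)}" using i m by auto
  qed (use surj m in auto)
  moreover have "inj_on \<pi> {i. i < length U \<and> P (U ! i)}"
    using bij by (auto simp: bij_betw_def intro: inj_on_subset)
  ultimately have "bij_betw \<pi> {i. i < length U \<and> P (U ! i)} {i. i < length V \<and> P (V ! i)}"
    by (simp add: bij_betw_def)
  then show ?thesis by (simp add: length_filter_conv_card bij_betw_same_card)
qed

text \<open>\<open>P\<close> selects the forms proportional to a member of the coset of
  \<open>y\<close> modulo the span of \<open>I\<close>. Matchings preserve \<open>P\<close>, and the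
  choice of \<open>y\<close> makes all such forms outer, so both counts equal the one in the common
  source \<open>V\<close>.\<close>

lemma blocking_subset_class_count:
  fixes C :: "('a::field, 'n::finite) circuit"
  assumes block: "blocking_subset C S I Q" and "a \<in> Q" "b \<in> Q"
    and y: "y \<notin> vec.span (S \<union> set I)"
  defines "P \<equiv> \<lambda>u. \<exists>c. c \<noteq> 0 \<and> u - c *s y \<in> vec.span (set I)"
  shows "length (filter P (snd (C ! a))) = length (filter P (snd (C ! b)))"
proof -
  obtain V \<tau> where \<tau>: "\<And>q. q \<in> Q \<Longrightarrow> ordered_matching I V (outer_forms S I (snd (C ! q))) (\<tau> q)"
    using block unfolding blocking_subset_def by blast
  have P_out: "u \<notin> vec.span (S \<union> set I)" if "P u" for u
  proof
    assume u: "u \<in> vec.span (S \<union> set I)"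
    obtain c where c: "c \<noteq> 0" "u - c *s y \<in> vec.span (set I)" using \<open>P u\<close> by (auto simp: P_def)
    then have "u - c *s y \<in> vec.span (S \<union> set I)" using vec.span_mono[of "set I" "S \<union> set I"] by blast
    then have "u - (u - c *s y) \<in> vec.span (S \<union> set I)" using u vec.span_diff by blast
    then show False using y c(1) by (simp add: scale_mem_span_iff)
  qed
  have P_matches: "P m \<longleftrightarrow> P l" if "matches I l m e" for l m e
  proof -
    obtain j w where e: "e \<noteq> 0" and w: "w \<in> prefix_span I j" "m = e *s l + w"
      using \<open>matches I l m e\<close> unfolding matches_def by blast
    have w': "w \<in> vec.span (set I)"
      using w(1) vec.span_mono[OF set_take_subset] by (auto simp: prefix_span_def)
    show ?thesis
    proof
      assume "P m"
      then obtain c where c: "c \<noteq> 0" "m - c *s y \<in> vec.span (set I)" by (auto simp: P_def)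
      then have "inverse e *s ((m - c *s y) - w) \<in> vec.span (set I)"
        using w' vec.span_scale vec.span_diff by blast
      moreover have "inverse e *s ((m - c *s y) - w) = l - (inverse e * c) *s y"
        using e w(2) by (simp add: vec.scale_right_diff_distrib)
      ultimately show "P l" unfolding P_def using c e by (intro exI[of _ "inverse e * c"]) simp
    next
      assume "P l"
      then obtain c where c: "c \<noteq> 0" "l - c *s y \<in> vec.span (set I)" by (auto simp: P_def)
      then have "e *s (l - c *s y) + w \<in> vec.span (set I)"
        using w' by (intro vec.span_add vec.span_scale)
      moreover have "e *s (l - c *s y) + w = m - (e * c) *s y"
        using w(2) by (simp add: vec.scale_right_diff_distrib)
      ultimately show "P m" unfolding P_def using c e by (intro exI[of _ "e * c"]) simp
    qed
  qed
  have "length (filter P (snd (C ! q))) = length (filter P V)" if q: "q \<in> Q" for q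
  proof -
    have "filter P (snd (C ! q)) = filter P (outer_forms S I (snd (C ! q)))"
      unfolding outer_forms_def filter_filter by (intro filter_cong) (use P_out in auto)
    then show ?thesis using ordered_matching_length_filter[OF \<tau>[OF q] P_matches] by simp
  qed
  then show ?thesis using assms by simp
qed

text \<open>The total count over the coset of \<open>y\<close> is the same for \<open>a\<close> and
  \<open>b\<close>, so a discrepancy at \<open>y\<close> must be compensated elsewhere in the
  coset.\<close>

lemma blocking_subset_alternates:
  fixes C :: "('a::field, 'n::finite) circuit"
  assumes block: "blocking_subset C S I Q" and ab: "a \<in> Q" "b \<in> Q"
    and y: "y \<notin> vec.span (S \<union> set I)"
    and neq: "prop_count y (snd (C ! a)) \<noteq> prop_count y (snd (C ! b))"
  obtains z where "z \<noteq> y" "z - y \<in> vec.span (set I)"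
    "prop_count z (snd (C ! a)) \<noteq> prop_count z (snd (C ! b))"
proof (rule ccontr)
  assume "\<not> thesis"
  with that have eq: "prop_count z (snd (C ! a)) = prop_count z (snd (C ! b))"
    if "z \<noteq> y" "z - y \<in> vec.span (set I)" for z
    using that by blast
  let ?U = "snd (C ! a)" and ?V = "snd (C ! b)"
  have yI: "y \<notin> vec.span (set I)" using y vec.span_mono[of "set I" "S \<union> set I"] by blast
  \<comment> \<open>The coset may be infinite; only members proportional to an entry of one of the
    lists contribute, at most one per entry. \<open>y\<close> is inserted so that its count can be
    split off.\<close>
  define Z where "Z = insert y (\<Union>u\<in>set ?U \<union> set ?V. {z. z - y \<in> vec.span (set I) \<and> proportional z u})"
  have Z_coset: "z - y \<in> vec.span (set I)" if "z \<in> Z" for z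
    using that by (auto simp: Z_def vec.span_zero)
  have "finite {z. z - y \<in> vec.span (set I) \<and> proportional z u}" for u
  proof (cases "\<exists>z0. z0 - y \<in> vec.span (set I) \<and> proportional z0 u")
    case True
    then obtain z0 where "z0 - y \<in> vec.span (set I)" "proportional z0 u" by blast
    then have "{z. z - y \<in> vec.span (set I) \<and> proportional z u} \<subseteq> {z0}"
      using proportional_coset_unique[OF yI] by blast
    then show ?thesis by (rule finite_subset) simp
  next
    case False
    then have "{z. z - y \<in> vec.span (set I) \<and> proportional z u} = {}" by blast
    then show ?thesis by (simp only: finite.emptyI)
  qed
  then have finZ: "finite Z" by (simp add: Z_def)
  have count: "(\<Sum>z\<in>Z. prop_count z W)
      = length (filter (\<lambda>u. \<exists>c. c \<noteq> 0 \<and> u - c *s y \<in> vec.span (set I)) W)"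
    if W: "set W \<subseteq> set ?U \<union> set ?V" for W
  proof -
    have "(\<Sum>z\<in>Z. prop_count z W) = length (filter (\<lambda>u. \<exists>z\<in>Z. proportional z u) W)"
      using proportional_coset_unique[OF yI Z_coset Z_coset] by (intro sum_prop_count finZ)
    also have "filter (\<lambda>u. \<exists>z\<in>Z. proportional z u) W
        = filter (\<lambda>u. \<exists>c. c \<noteq> 0 \<and> u - c *s y \<in> vec.span (set I)) W"
    proof (rule filter_cong[OF refl])
      fix u assume u: "u \<in> set W"
      show "(\<exists>z\<in>Z. proportional z u) \<longleftrightarrow> (\<exists>c. c \<noteq> 0 \<and> u - c *s y \<in> vec.span (set I))"
      proof
        assume "\<exists>z\<in>Z. proportional z u"
        then obtain z c where z: "z \<in> Z" "c \<noteq> 0" "u = c *s z" by (auto simp: proportional_def)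
        then have "c *s (z - y) \<in> vec.span (set I)" using Z_coset by (intro vec.span_scale)
        then show "\<exists>c. c \<noteq> 0 \<and> u - c *s y \<in> vec.span (set I)"
          using z by (intro exI[of _ c]) (simp add: vec.scale_right_diff_distrib)
      next
        assume "\<exists>c. c \<noteq> 0 \<and> u - c *s y \<in> vec.span (set I)"
        then obtain c where c: "c \<noteq> 0" "u - c *s y \<in> vec.span (set I)" by blast
        then have "inverse c *s (u - c *s y) \<in> vec.span (set I)" by (intro vec.span_scale)
        then have "inverse c *s u - y \<in> vec.span (set I)"
          using c(1) by (simp add: vec.scale_right_diff_distrib)
        moreover have "proportional (inverse c *s u) u"
          using c(1) by (auto simp: proportional_def intro!: exI[of _ c])
        ultimately show "\<exists>z\<in>Z. proportional z u" using u W by (auto simp: Z_def)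
      qed
    qed
    finally show ?thesis .
  qed
  have "(\<Sum>z\<in>Z. prop_count z ?U) = (\<Sum>z\<in>Z. prop_count z ?V)"
    using count[of ?U] count[of ?V] blocking_subset_class_count[OF block ab y] by simp
  moreover have "(\<Sum>z\<in>Z - {y}. prop_count z ?U) = (\<Sum>z\<in>Z - {y}. prop_count z ?V)"
    using eq Z_coset by (intro sum.cong) auto
  moreover have "(\<Sum>z\<in>Z. prop_count z W) = prop_count y W + (\<Sum>z\<in>Z - {y}. prop_count z W)" for W
    by (rule sum.remove[OF finZ]) (simp add: Z_def)
  ultimately have "prop_count y ?U = prop_count y ?V" by (metis add_right_cancel)
  then show False using neq by contradiction
qed

text \<open>For \<open>n \<in> N\<close> the induction hypothesis is applied both to
  \<open>x\<close> and to its partner \<open>z\<close>. The resulting sets are disjoint, since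
  \<open>z - x\<close> is a nonzero element of the span of \<open>J n\<close> and so not in that of
  \<open>A n\<close>. The fixed bound \<open>M\<close> lets \<open>step\<close> apply to every
  partner met on the way down.\<close>

lemma doubling_along_orthogonal_sets:
  fixes J :: "nat \<Rightarrow> ('a::field ^ 'n::finite) set"
  defines "A \<equiv> \<lambda>n. \<Union>i<n. J i"
  assumes orth: "\<And>i. i \<in> N \<Longrightarrow> vec.span (A i) \<inter> vec.span (J i) = {0}"
    and step: "\<And>i y. i \<in> N \<Longrightarrow> G y \<Longrightarrow> y \<notin> vec.span (A (Suc i)) \<Longrightarrow>
      \<exists>z. z \<noteq> y \<and> z - y \<in> vec.span (J i) \<and> G z"
    and "n \<le> M" "G x" "x \<notin> vec.span (A M)"
  shows "\<exists>X. finite X \<and> X \<subseteq> {y. G y \<and> y - x \<in> vec.span (A n)} \<and> 2 ^ card (N \<inter> {..<n}) \<le> card X"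
  using assms(4-6)
proof (induction n arbitrary: x)
  case 0
  then show ?case by (intro exI[of _ "{x}"]) (auto simp: vec.span_zero)
next
  case (Suc n)
  have mono: "vec.span (A i) \<subseteq> vec.span (A j)" if "i \<le> j" for i j
    unfolding A_def using that by (intro vec.span_mono UN_mono) auto
  have J: "vec.span (J n) \<subseteq> vec.span (A (Suc n))"
    unfolding A_def by (intro vec.span_mono) auto
  obtain X where X: "finite X" "X \<subseteq> {y. G y \<and> y - x \<in> vec.span (A n)}"
    "2 ^ card (N \<inter> {..<n}) \<le> card X"
    using Suc by force
  show ?case
  proof (cases "n \<in> N")
    case False
    then have "N \<inter> {..<Suc n} = N \<inter> {..<n}" by (auto simp: less_Suc_eq)
    then show ?thesis using X mono[of n "Suc n"] by (intro exI[of _ X]) auto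
  next
    case True
    then have "N \<inter> {..<Suc n} = insert n (N \<inter> {..<n})" by (auto simp: less_Suc_eq)
    then have card: "card (N \<inter> {..<Suc n}) = Suc (card (N \<inter> {..<n}))" by simp
    have "x \<notin> vec.span (A (Suc n))" using Suc.prems mono by blast
    then obtain z where z: "z \<noteq> x" "z - x \<in> vec.span (J n)" "G z"
      using step[OF True] Suc.prems(2) by blast
    have "z \<notin> vec.span (A M)"
    proof
      assume "z \<in> vec.span (A M)"
      moreover have "z - x \<in> vec.span (A M)" using z(2) J mono[OF Suc.prems(1)] by blast
      ultimately have "z - (z - x) \<in> vec.span (A M)" by (rule vec.span_diff)
      then show False using Suc.prems(3) by simp
    qed
    then obtain Y where Y: "finite Y" "Y \<subseteq> {y. G y \<and> y - z \<in> vec.span (A n)}"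
      "2 ^ card (N \<inter> {..<n}) \<le> card Y"
      using Suc.IH[of z] Suc.prems(1) z(3) by force
    have "X \<inter> Y = {}"
    proof (rule ccontr)
      assume "X \<inter> Y \<noteq> {}"
      then obtain u where u: "u - x \<in> vec.span (A n)" "u - z \<in> vec.span (A n)" using X Y by auto
      then have "(u - x) - (u - z) \<in> vec.span (A n)" by (rule vec.span_diff)
      then have "z - x \<in> vec.span (A n)" by simp
      then have "z - x \<in> {0}" using z(2) orth[OF True] by blast
      then show False using z(1) by simp
    qed
    then have "2 ^ card (N \<inter> {..<Suc n}) \<le> card (X \<union> Y)"
      using X Y card by (simp add: card_Un_disjoint)
    moreover have "X \<union> Y \<subseteq> {y. G y \<and> y - x \<in> vec.span (A (Suc n))}"
    proof
      fix u assume "u \<in> X \<union> Y"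
      then consider "u \<in> X" | "u \<in> Y" by blast
      then show "u \<in> {y. G y \<and> y - x \<in> vec.span (A (Suc n))}"
      proof cases
        case 1
        then show ?thesis using X(2) mono[of n "Suc n"] by auto
      next
        case 2
        then have "u - z \<in> vec.span (A (Suc n))" "G u" using Y(2) mono[of n "Suc n"] by auto
        moreover have "z - x \<in> vec.span (A (Suc n))" using z(2) J by blast
        ultimately have "(u - z) + (z - x) \<in> vec.span (A (Suc n))" using vec.span_add by blast
        then show ?thesis using \<open>G u\<close> by simp
      qed
    qed
    ultimately show ?thesis using X(1) Y(1) by (intro exI[of _ "X \<union> Y"]) simp
  qed
qed

text \<open>Differing counts are not both 0, so each member of \<open>X\<close> claims an entry of
  \<open>U\<close> or \<open>V\<close>; lying in one coset off the span, different members claim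
  different entries.\<close>

lemma card_le_of_prop_count_differ:
  assumes "finite X" "x \<notin> vec.span A" "\<And>y. y \<in> X \<Longrightarrow> y - x \<in> vec.span A"
    and "\<And>y. y \<in> X \<Longrightarrow> prop_count y U \<noteq> prop_count y V"
  shows "card X \<le> length U + length V"
proof -
  have le: "(\<Sum>y\<in>X. prop_count y W) \<le> length W" for W
  proof -
    have "(\<Sum>y\<in>X. prop_count y W) = length (filter (\<lambda>u. \<exists>y\<in>X. proportional y u) W)"
      using proportional_coset_unique[OF assms(2,3,3)] by (intro sum_prop_count assms(1))
    then show ?thesis by simp
  qed
  have "card X = (\<Sum>y\<in>X. 1)" by simp
  also have "\<dots> \<le> (\<Sum>y\<in>X. prop_count y U + prop_count y V)"
    by (intro sum_mono) (use assms(4) in force)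
  also have "\<dots> \<le> length U + length V"
    using le[of U] le[of V] by (simp add: sum.distrib)
  finally show ?thesis .
qed

section \<open>The length of a chain\<close>

text \<open>Extends \<open>chain_S\<close> past the last step: at \<open>Suc n\<close> it is the set
  of all forms of \<open>S\<close> and \<open>I\<close> at step \<open>n\<close>, even when
  \<open>Suc n = length T\<close>.\<close>

definition chain_forms :: "('a::field, 'n::finite) chain \<Rightarrow> nat \<Rightarrow> ('a ^ 'n) set" where
  "chain_forms T n = (\<Union>i<n. set (chain_I T i))"

lemma chain_forms_Suc: "chain_forms T (Suc n) = chain_forms T n \<union> set (chain_I T n)"
  by (auto simp: chain_forms_def less_Suc_eq)

lemma chain_S_eq_chain_forms:
  assumes "form_ideal_chain C T" "n < length T"
  shows "chain_S T n = chain_forms T n"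
  using assms(2)
proof (induction n)
  case 0
  then show ?case using assms(1) by (simp add: form_ideal_chain_def chain_forms_def)
next
  case (Suc n)
  have "chain_S T (Suc n) = chain_S T n \<union> set (chain_I T n)"
    using assms(1) Suc.prems unfolding form_ideal_chain_def
    by (metis diff_Suc_1 zero_less_Suc)
  then show ?case using Suc by (simp add: chain_forms_Suc)
qed

definition separating_steps ::
  "('a::field, 'n::finite) circuit \<Rightarrow> ('a, 'n) chain \<Rightarrow> nat \<Rightarrow> nat \<Rightarrow> nat set" where
  "separating_steps C T a b = {n. n < length T \<and> a \<in> chain_Q T n \<and> b \<in> chain_Q T n \<and>
     (\<exists>x. x \<notin> vec.span (chain_forms T (Suc n)) \<and>
       prop_count x (snd (C ! a)) \<noteq> prop_count x (snd (C ! b)))}"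

text \<open>A witness of the last separating step lies off the spans of all earlier steps, so the
  doubling applies to it with \<open>M = Suc n\<close>. The empty case is separate because
  \<open>1 \<le> 2 * d\<close> fails for \<open>d = 0\<close>.\<close>

lemma card_separating_steps:
  fixes C :: "('a::field, 'n::finite) circuit"
  assumes chain: "form_ideal_chain C T"
    and len: "length (snd (C ! a)) = d" "length (snd (C ! b)) = d"
  shows "separating_steps C T a b = {} \<or> 2 ^ card (separating_steps C T a b) \<le> 2 * d"
proof (cases "separating_steps C T a b = {}")
  case False
  let ?N = "separating_steps C T a b"
  let ?G = "\<lambda>y. prop_count y (snd (C ! a)) \<noteq> prop_count y (snd (C ! b))"
  have fin: "finite ?N" by (simp add: separating_steps_def)
  define n where "n = Max ?N"
  have n: "n \<in> ?N" using Max_in[OF fin False] by (simp add: n_def)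
  have "?N \<inter> {..<Suc n} = ?N" using Max_ge[OF fin] by (auto simp: n_def less_Suc_eq_le)
  obtain x where x: "x \<notin> vec.span (chain_forms T (Suc n))" "?G x"
    using n by (auto simp: separating_steps_def)
  have props: "i < length T" "a \<in> chain_Q T i" "b \<in> chain_Q T i"
    "vec.span (chain_forms T i) \<inter> vec.span (set (chain_I T i)) = {0}"
    "blocking_subset C (chain_forms T i) (chain_I T i) (chain_Q T i)" if "i \<in> ?N" for i
  proof -
    show i: "i < length T" "a \<in> chain_Q T i" "b \<in> chain_Q T i"
      using that by (simp_all add: separating_steps_def)
    show "vec.span (chain_forms T i) \<inter> vec.span (set (chain_I T i)) = {0}"
      "blocking_subset C (chain_forms T i) (chain_I T i) (chain_Q T i)"
      using i(1) chain unfolding chain_S_eq_chain_forms[OF chain i(1), symmetric]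
      by (simp_all add: form_ideal_chain_def orthogonal_forms_def)
  qed
  have "\<exists>X. finite X \<and> X \<subseteq> {y. ?G y \<and> y - x \<in> vec.span (chain_forms T (Suc n))}
      \<and> 2 ^ card (?N \<inter> {..<Suc n}) \<le> card X"
    unfolding chain_forms_def
  proof (rule doubling_along_orthogonal_sets[where M = "Suc n"])
    fix i y assume "i \<in> ?N" "?G y" "y \<notin> vec.span (\<Union>i<Suc i. set (chain_I T i))"
    then show "\<exists>z. z \<noteq> y \<and> z - y \<in> vec.span (set (chain_I T i)) \<and> ?G z"
      using blocking_subset_alternates[OF props(5) props(2,3)]
      by (metis chain_forms_Suc chain_forms_def)
  qed (use props(4) x in \<open>auto simp: chain_forms_def\<close>)
  then obtain X where X: "finite X" "X \<subseteq> {y. ?G y \<and> y - x \<in> vec.span (chain_forms T (Suc n))}"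
    "2 ^ card ?N \<le> card X"
    using \<open>?N \<inter> {..<Suc n} = ?N\<close> by auto
  have "card X \<le> length (snd (C ! a)) + length (snd (C ! b))"
    using X by (intro card_le_of_prop_count_differ[OF X(1) x(1)]) auto
  then show ?thesis using X(3) len by simp
qed simp

text \<open>Classes are encoded by their count functions, cut to 0 on the span, so that passing to a
  larger span is a map on classes.\<close>

definition classes_off_span ::
  "('a::field, 'n::finite) circuit \<Rightarrow> ('a, 'n) chain \<Rightarrow> nat \<Rightarrow> ('a ^ 'n \<Rightarrow> nat) set" where
  "classes_off_span C T n =
     (\<lambda>a x. if x \<in> vec.span (chain_forms T n) then 0 else prop_count x (snd (C ! a))) ` {..<length C}"

text \<open>The number of classes is a potential: it starts at no more than \<open>length C\<close>,
  never grows, and drops at every non-separating step.\<close>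

lemma card_nonseparating_steps:
  fixes C :: "('a::field, 'n::{finite,linorder}) circuit"
  assumes chain: "form_ideal_chain C T" and min: "minimal_circuit C" and "n \<le> length T"
  shows "card ({..<n} - (\<Union>a\<in>UNIV. \<Union>b\<in>UNIV. separating_steps C T a b))
    + card (classes_off_span C T n) \<le> length C"
  using assms(3)
proof (induction n)
  case 0
  have "card (classes_off_span C T 0) \<le> card {..<length C}"
    unfolding classes_off_span_def by (intro card_image_le) simp
  then show ?case by simp
next
  case (Suc n)
  let ?Sep = "\<Union>a\<in>UNIV. \<Union>b\<in>UNIV. separating_steps C T a b"
  let ?f = "\<lambda>n a x. if x \<in> vec.span (chain_forms T n) then 0 else prop_count x (snd (C ! a))"
  \<comment> \<open>\<open>r\<close> maps the classes at \<open>n\<close> onto those at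
    \<open>Suc n\<close>; the number of classes drops once \<open>r\<close> fails to be
    injective.\<close>
  define r where "r f = (\<lambda>x. if x \<in> vec.span (chain_forms T (Suc n)) then 0 else f x)"
    for f :: "('a, 'n) vec \<Rightarrow> nat"
  have mono: "vec.span (chain_forms T n) \<subseteq> vec.span (chain_forms T (Suc n))"
    by (intro vec.span_mono) (auto simp: chain_forms_Suc)
  have r: "r (?f n a) = ?f (Suc n) a" for a
    using mono unfolding r_def by (intro ext) auto
  have img: "classes_off_span C T (Suc n) = r ` classes_off_span C T n"
    unfolding classes_off_span_def image_image r ..
  have fin: "finite (classes_off_span C T n)" by (simp add: classes_off_span_def)
  have le: "card (classes_off_span C T (Suc n)) \<le> card (classes_off_span C T n)"
    unfolding img using fin by (rule card_image_le)
  show ?case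
  proof (cases "n \<in> ?Sep")
    case True
    then have "{..<Suc n} - ?Sep = {..<n} - ?Sep" by (auto simp: less_Suc_eq)
    then show ?thesis using Suc le by simp
  next
    case False
    then have "{..<Suc n} - ?Sep = insert n ({..<n} - ?Sep)" by (auto simp: less_Suc_eq)
    then have card: "card ({..<Suc n} - ?Sep) = Suc (card ({..<n} - ?Sep))" by simp
    have n: "n < length T" using Suc.prems by simp
    then have "orthogonal_forms (chain_I T n) (chain_forms T n)"
      and block: "blocking_subset C (chain_forms T n) (chain_I T n) (chain_Q T n)"
      using chain chain_S_eq_chain_forms[OF chain n] by (auto simp: form_ideal_chain_def)
    \<comment> \<open>These two terms are told apart at \<open>n\<close>, yet by non-separation only
      inside the next span, so \<open>r\<close> identifies their classes.\<close>
    then obtain a b x where ab: "a \<in> chain_Q T n" "b \<in> chain_Q T n"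
      and x: "x \<notin> vec.span (chain_forms T n)"
      "prop_count x (snd (C ! a)) \<noteq> prop_count x (snd (C ! b))"
      using blocking_subset_separates[OF min] by metis
    have abC: "a < length C" "b < length C" using ab block by (auto simp: blocking_subset_def)
    have "n \<notin> separating_steps C T a b" using False by blast
    then have "x \<in> vec.span (chain_forms T (Suc n)) \<or>
        prop_count x (snd (C ! a)) = prop_count x (snd (C ! b))" for x
      using n ab by (auto simp: separating_steps_def)
    then have "?f (Suc n) a = ?f (Suc n) b" by (intro ext) auto
    then have "r (?f n a) = r (?f n b)" using r by simp
    moreover have "?f n a \<noteq> ?f n b" using x by (auto dest: fun_cong[of _ _ x])
    moreover have "?f n a \<in> classes_off_span C T n" "?f n b \<in> classes_off_span C T n"
      using abC by (auto simp: classes_off_span_def)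
    ultimately have "\<not> inj_on r (classes_off_span C T n)" unfolding inj_on_def by blast
    then have "card (classes_off_span C T (Suc n)) \<noteq> card (classes_off_span C T n)"
      unfolding img using fin by (metis eq_card_imp_inj_on)
    then show ?thesis using Suc card le by simp
  qed
qed

section \<open>Counting separating and non-separating steps\<close>

theorem theorem5:
  fixes C :: "('a::field, 'n::{finite,linorder}) circuit"
    and T :: "('a, 'n) chain"
    and k d :: nat
  assumes "depth3_circuit k d C"
    and "is_identity C"
    and "simple_circuit C"
    and "minimal_circuit C"
    and "maximal_chain C T"
  shows "real (length T) \<le> real (k choose 2) * (log 2 (real d) + 3) + (real k - 1)"
proof -
  have chain: "form_ideal_chain C T" using assms(5) by (simp add: maximal_chain_def)
  have k: "length C = k" and len: "\<And>a. a < k \<Longrightarrow> length (snd (C ! a)) = d"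
    using assms(1) by (auto simp: depth3_circuit_def)
  have Q: "chain_Q T n \<subseteq> {..<k}" "1 < k" if "n < length T" for n
    using chain that k by (auto simp: form_ideal_chain_def blocking_subset_def)
  have "1 < k" using chain Q(2)[of 0] by (simp add: form_ideal_chain_def)
  define Sep where "Sep = (\<Union>a\<in>UNIV. \<Union>b\<in>UNIV. separating_steps C T a b)"
  define E where "E = {e. e \<subseteq> {..<k} \<and> card e = 2}"
  \<comment> \<open>Ranging over all ordered choices from \<open>e\<close> avoids ordering the pair:
    the sets are symmetric in \<open>a\<close> and \<open>b\<close> and empty on the
    diagonal.\<close>
  define N where "N e = (\<Union>a\<in>e. \<Union>b\<in>e. separating_steps C T a b)" for e
  have fin_E: "finite E" by (simp add: E_def)
  have card_E: "card E = k choose 2" unfolding E_def using n_subsets[of "{..<k}" 2] by simp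
  \<comment> \<open>For \<open>d = 0\<close> the logarithm takes its default value 0.\<close>
  have log_nonneg: "0 \<le> log 2 (real d)" by (cases "d = 0") (auto simp: log_def)
  have card_N: "real (card (N e)) \<le> log 2 (real d) + 3" if "e \<in> E" for e
  proof -
    have "e \<subseteq> {..<k}" "card e = 2" using that by (simp_all add: E_def)
    then obtain a b where e: "e = {a, b}" "a < k" "b < k" by (auto simp: card_2_iff)
    have "separating_steps C T b a = separating_steps C T a b"
      unfolding separating_steps_def by (intro Collect_cong) (auto dest: not_sym)
    moreover have "separating_steps C T a a = {}" "separating_steps C T b b = {}"
      by (auto simp: separating_steps_def)
    ultimately have N: "N e = separating_steps C T a b" by (auto simp: N_def e(1))
    show ?thesis
    proof (cases "N e = {}")
      case False
      then have le: "2 ^ card (N e) \<le> 2 * d"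
        using card_separating_steps[OF chain len[OF e(2)] len[OF e(3)]] N by simp
      have d: "0 < d"
      proof (rule ccontr)
        assume "\<not> 0 < d"
        then show False using le by simp
      qed
      have "real (2 ^ card (N e)) \<le> real (2 * d)" using le by (rule of_nat_mono)
      then have "2 powr real (card (N e)) \<le> 2 * real d" by (simp add: powr_realpow)
      then have "real (card (N e)) \<le> log 2 (2 * real d)" using d by (simp add: le_log_iff)
      \<comment> \<open>The 1 comes from counting the factors of two terms, \<open>2 * d\<close> in
        all; it stays below the 3 of the claim.\<close>
      also have "\<dots> = 1 + log 2 (real d)" using d by (simp add: log_mult)
      finally show ?thesis by simp
    qed (use log_nonneg in simp)
  qed
  have "Sep \<subseteq> (\<Union>e\<in>E. N e)"
  proof
    fix n assume "n \<in> Sep"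
    then obtain a b where ab: "n \<in> separating_steps C T a b" by (auto simp: Sep_def)
    then have "a \<noteq> b" "a < k" "b < k" using Q(1)[of n] by (auto simp: separating_steps_def)
    then have "{a, b} \<in> E" by (simp add: E_def)
    moreover have "n \<in> N {a, b}" using ab by (auto simp: N_def)
    ultimately show "n \<in> (\<Union>e\<in>E. N e)" by blast
  qed
  moreover have "finite (\<Union>e\<in>E. N e)"
    using fin_E by (auto simp: N_def separating_steps_def E_def intro: finite_subset)
  ultimately have "card Sep \<le> card (\<Union>e\<in>E. N e)" by (intro card_mono)
  also have "\<dots> \<le> (\<Sum>e\<in>E. card (N e))" using fin_E by (rule card_UN_le)
  finally have "real (card Sep) \<le> (\<Sum>e\<in>E. real (card (N e)))" by (simp flip: of_nat_sum)
  also have "\<dots> \<le> real (card E) * (log 2 (real d) + 3)"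
    using card_N by (intro sum_bounded_above)
  finally have sep: "real (card Sep) \<le> real (k choose 2) * (log 2 (real d) + 3)"
    by (simp add: card_E)
  have "card ({..<length T} - Sep) + card (classes_off_span C T (length T)) \<le> k"
    using card_nonseparating_steps[OF chain assms(4), of "length T"] k by (simp add: Sep_def)
  \<comment> \<open>At least one class survives to the end, which turns the bound \<open>k\<close>
    into \<open>k - 1\<close>.\<close>
  moreover have "card (classes_off_span C T (length T)) \<noteq> 0"
    using \<open>1 < k\<close> k by (auto simp: classes_off_span_def lessThan_empty_iff)
  ultimately have nonsep: "card ({..<length T} - Sep) + 1 \<le> k" by linarith
  have fin_Sep: "finite Sep" by (rule finite_subset[of _ "{..<length T}"]) (auto simp: Sep_def separating_steps_def)
  have "length T = card {..<length T}" by simp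
  also have "\<dots> \<le> card (({..<length T} - Sep) \<union> Sep)" using fin_Sep by (intro card_mono) auto
  also have "\<dots> \<le> card ({..<length T} - Sep) + card Sep" by (rule card_Un_le)
  finally have "length T \<le> card ({..<length T} - Sep) + card Sep" .
  then show ?thesis using nonsep sep by linarith
qed

end
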